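(* Let $N_0,t_0$ be integers with $1\le t_0\le N_0$ such that $\alpha=\frac{\log t_0}{\log N_0}$ satisfies $0<\alpha<1$, and let $C_1>1$. There is $N_*=N_*(\alpha,C_1)$ such that if $N=N_0^n\ge N_*$ (with $n$ a positive integer and $t=t_0^n$), then the measure $\sigma$ produced by the Cantor-type construction with parameters $N,t$ satisfies $$\sigma([x,x+\epsilon])\le C_1\epsilon^{\alpha}\quad\text{for all }x\in\mathbb{R}\text{ and all }0<\epsilon\le1 .$$
   Context: Cantor-type construction. Let $N=N_0^n$, $t=t_0^n$, so $\alpha=\frac{\log t}{\log N}$, and put $K=2^N$, $M_j=KN^j$, $T_j=Kt^j$ ($j\ge0$). Let $A_0=\{0,\frac1K,\dots,\frac{K-1}{K}\}$ and $A_{j+1}=\bigcup_{a\in A_j}A_{j+1,a}$, where for each $a\in A_j$ the set $A_{j+1,a}$ is a subset of $\{a,a+\frac{1}{M_{j+1}},\dots,a+\frac{N-1}{M_{j+1}}\}$ with $\#A_{j+1,a}=t$ (the choice of these subsets being otherwise arbitrary); thus $\#A_j=T_j$. Let $E_j=\bigcup_{a\in A_j}[a,a+M_j^{-1}]$ and $E=\bigcap_{j\ge1}E_j$. Let $\mathcal{B}_j$ be the family of intervals $[a,a+M_j^{-1}]$, $a\in A_j$. The measure $\sigma$ on $E$ is given by $\sigma(F)=\inf\{\sum_{i=1}^\infty T_{j(i)}^{-1}:\ F\subset\bigcup_{i=1}^\infty I_i,\ I_i\in\mathcal{B}_{j(i)}\}$ for $F\subset E$; it is the weak limit of the absolutely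 continuous probability measures with densities $\phi_j=\sum_{a\in A_j}T_j^{-1}M_j\mathbf{1}_{[a,a+M_j^{-1}]}$, and $\sigma(I)=T_j^{-1}$ for $I\in\mathcal{B}_j$. *)

theory Defs
  imports "HOL-Analysis.Analysis"
begin

text \<open>
  The parameters of the construction are \<open>N\<close>, \<open>t\<close> and the arbitrary choice \<open>S\<close> of subsets:
  \<open>S j a\<close> is the set $A_{j,a}$, and is only relevant for $j \ge 1$ and $a \in A_{j-1}$.
\<close>

definition cantor_K :: "nat \<Rightarrow> nat" where
  "cantor_K N = 2 ^ N"

definition cantor_M :: "nat \<Rightarrow> nat \<Rightarrow> nat" where
  "cantor_M N j = cantor_K N * N ^ j"

definition cantor_T :: "nat \<Rightarrow> nat \<Rightarrow> nat \<Rightarrow> nat" where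
  "cantor_T N t j = cantor_K N * t ^ j"

primrec cantor_A :: "nat \<Rightarrow> (nat \<Rightarrow> real \<Rightarrow> real set) \<Rightarrow> nat \<Rightarrow> real set" where
  "cantor_A N S 0 = (\<lambda>k. real k / real (cantor_K N)) ` {..<cantor_K N}"
| "cantor_A N S (Suc j) = (\<Union>a\<in>cantor_A N S j. S (Suc j) a)"

definition cantor_choice :: "nat \<Rightarrow> nat \<Rightarrow> (nat \<Rightarrow> real \<Rightarrow> real set) \<Rightarrow> bool" where
  "cantor_choice N t S \<longleftrightarrow>
     (\<forall>j. \<forall>a\<in>cantor_A N S j.
        S (Suc j) a \<subseteq> (\<lambda>k. a + real k / real (cantor_M N (Suc j))) ` {..<N} \<and>
        card (S (Suc j) a) = t)"

definition cantor_B :: "nat \<Rightarrow> (nat \<Rightarrow> real \<Rightarrow> real set) \<Rightarrow> nat \<Rightarrow> real set set" where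
  "cantor_B N S j = (\<lambda>a. {a .. a + 1 / real (cantor_M N j)}) ` cantor_A N S j"

definition cantor_E :: "nat \<Rightarrow> (nat \<Rightarrow> real \<Rightarrow> real set) \<Rightarrow> real set" where
  "cantor_E N S = (\<Inter>j\<in>{1..}. \<Union>(cantor_B N S j))"

text \<open>
  The set function \<open>\<sigma>\<close>, meant for subsets \<open>F\<close> of the Cantor set \<open>E\<close>. A set that is not covered
  by the basic intervals has infimum \<open>\<infinity>\<close>, so the \<open>\<sigma>\<close>-mass of an arbitrary \<open>J \<subseteq> \<real>\<close>
  has to be written as \<open>\<sigma> (J \<inter> E)\<close>.
\<close>

definition cantor_sigma ::
    "nat \<Rightarrow> nat \<Rightarrow> (nat \<Rightarrow> real \<Rightarrow> real set) \<Rightarrow> real set \<Rightarrow> ennreal" where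
  "cantor_sigma N t S F =
     Inf {(\<Sum>i. ennreal (1 / real (cantor_T N t (j i)))) | (j :: nat \<Rightarrow> nat) (I :: nat \<Rightarrow> real set).
            F \<subseteq> (\<Union>i. I i) \<and> (\<forall>i. I i \<in> cantor_B N S (j i))}"

end

theory Submission
  imports Defs "HOL-Real_Asymp.Real_Asymp"
begin

text \<open>
  Since \<open>\<sigma>\<close> is an infimum over covers, an upper bound needs only one good cover. Let \<open>M\<^sub>j\<close>,
  \<open>T\<^sub>j\<close>, \<open>K\<close> be the numbers of the construction. The left endpoints at level \<open>j\<close> lie in the
  grid of mesh \<open>1 / M\<^sub>j\<close>, so an interval of length \<open>\<epsilon>\<close> meets at most \<open>u + 2\<close> basic intervals
  of that level, where \<open>u = M\<^sub>j \<epsilon>\<close>; hence its mass is at most \<open>(u + 2) / T\<^sub>j\<close>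
  (\<open>cantor_sigma_interval_le\<close>).

  The level is the first one whose mesh is at most \<open>\<epsilon>\<close>. As \<open>t = N\<^sup>\<alpha>\<close>, one has
  \<open>\<epsilon>\<^sup>\<alpha> = u\<^sup>\<alpha> / (K\<^sup>\<alpha> t\<^sup>j)\<close>, whereas the bound on the mass is \<open>(u + 2) / (K t\<^sup>j)\<close>.
  At level \<open>0\<close> that bound is \<open>\<epsilon> + 2 / K\<close>, with \<open>\<epsilon> \<le> \<epsilon>\<^sup>\<alpha>\<close> and
  \<open>2 / K\<close> at most \<open>(C\<^sub>1 - 1) K\<^bsup>-\<alpha>\<^esup> \<le> (C\<^sub>1 - 1) \<epsilon>\<^sup>\<alpha>\<close> once \<open>K\<close> is large; this is
  where \<open>C\<^sub>1 > 1\<close> enters. At a later level \<open>1 \<le> u \<le> N\<close> by the choice of the level, so that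
  \<open>u + 2 \<le> 3 N\<^bsup>1-\<alpha>\<^esup> u\<^sup>\<alpha>\<close>, and the factor \<open>K\<^bsup>1-\<alpha>\<^esup>\<close> gained from the \<open>K\<close> initial
  intervals absorbs \<open>3 N\<^bsup>1-\<alpha>\<^esup>\<close> because \<open>K = 2\<^sup>N\<close> is exponentially large.
\<close>

section \<open>The levels of the construction\<close>

lemma cantor_M_pos: "0 < N \<Longrightarrow> 0 < cantor_M N j"
  by (simp add: cantor_M_def cantor_K_def)

lemma cantor_A_in_grid:
  assumes "cantor_choice N t S" and "0 < N" and "a \<in> cantor_A N S j"
  shows "\<exists>m :: nat. a = real m / real (cantor_M N j)"
  using assms(3)
proof (induction j arbitrary: a)
  case 0
  then show ?case by (auto simp: cantor_M_def)
next
  case (Suc j)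
  then obtain b where b: "b \<in> cantor_A N S j" "a \<in> S (Suc j) b" by auto
  obtain k where k: "a = b + real k / real (cantor_M N (Suc j))"
    using assms(1) b unfolding cantor_choice_def by blast
  obtain m where m: "b = real m / real (cantor_M N j)"
    using Suc.IH b(1) by blast
  have "b = real (N * m) / real (cantor_M N (Suc j))"
    using assms(2) by (simp add: m cantor_M_def)
  then have "a = real (N * m + k) / real (cantor_M N (Suc j))"
    using k by (simp add: add_divide_distrib)
  then show ?case by blast
qed

lemma cantor_A_nonempty:
  assumes "cantor_choice N t S" and "0 < t"
  shows "cantor_A N S j \<noteq> {}"
proof (induction j)
  case 0
  then show ?case by (auto simp: cantor_K_def lessThan_empty_iff)
next
  case (Suc j)
  then obtain a where a: "a \<in> cantor_A N S j" by blast
  then have "card (S (Suc j) a) = t"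
    using assms(1) by (simp add: cantor_choice_def)
  then have "S (Suc j) a \<noteq> {}" using assms(2) by auto
  then show ?case using a by auto
qed

lemma cantor_B_union_antimono:
  assumes "cantor_choice N t S" and "0 < N"
  shows "\<Union>(cantor_B N S (Suc j)) \<subseteq> \<Union>(cantor_B N S j)"
proof
  fix y assume "y \<in> \<Union>(cantor_B N S (Suc j))"
  then obtain a b where ab: "b \<in> cantor_A N S j" "a \<in> S (Suc j) b"
    "a \<le> y" "y \<le> a + 1 / real (cantor_M N (Suc j))"
    by (auto simp: cantor_B_def)
  obtain k where k: "a = b + real k / real (cantor_M N (Suc j))" "k < N"
    using assms(1) ab(1,2) unfolding cantor_choice_def by blast
  have M: "real (cantor_M N (Suc j)) = real N * real (cantor_M N j)" "real (cantor_M N j) > 0"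
    using cantor_M_pos[OF assms(2)] by (simp_all add: cantor_M_def)
  have "y \<le> b + (real k + 1) / real (cantor_M N (Suc j))"
    using ab(4) k(1) by (simp add: add_divide_distrib)
  also have "(real k + 1) / real (cantor_M N (Suc j)) \<le> real N / real (cantor_M N (Suc j))"
    using k(2) by (intro divide_right_mono) auto
  also have "\<dots> = 1 / real (cantor_M N j)" using M assms(2) by simp
  finally have "y \<le> b + 1 / real (cantor_M N j)" by simp
  moreover have "b \<le> a" by (simp add: k(1))
  ultimately show "y \<in> \<Union>(cantor_B N S j)"
    using ab(1,3) unfolding cantor_B_def by (intro UnionI[OF imageI]) auto
qed

text \<open>The set \<open>E\<close> is an intersection over levels \<open>j \<ge> 1\<close>; nestedness adds level \<open>0\<close>.\<close>

lemma cantor_E_subset_level: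
  assumes "cantor_choice N t S" and "0 < N"
  shows "cantor_E N S \<subseteq> \<Union>(cantor_B N S j)"
proof (cases j)
  case 0
  have "cantor_E N S \<subseteq> \<Union>(cantor_B N S (Suc 0))" by (auto simp: cantor_E_def)
  then show ?thesis using cantor_B_union_antimono[OF assms, of 0] 0 by blast
qed (auto simp: cantor_E_def)

section \<open>Bounding the mass by finite covers\<close>

text \<open>
  Covers in the definition of \<open>\<sigma>\<close> are infinite sequences that may not contain the empty set. A
  finite cover is therefore completed by basic intervals of levels \<open>p, p + 1, \<dots>\<close>; as \<open>t \<ge> 2\<close>,
  these cost at most \<open>2\<^bsup>1-p\<^esup>\<close> in total, which tends to \<open>0\<close>.
\<close>

lemma cantor_sigma_le_finite_cover:
  assumes S: "cantor_choice N t S" and t: "2 \<le> t"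
    and F: "F \<subseteq> cantor_A N S l" "finite F"
    and G: "G \<subseteq> (\<Union>a\<in>F. {a .. a + 1 / real (cantor_M N l)})"
  shows "cantor_sigma N t S G \<le> ennreal (real (card F) / real (cantor_T N t l))"
proof (rule ennreal_le_epsilon)
  fix e :: real assume "0 < e"
  define c where "c = card F"
  define w where "w = 1 / real (cantor_T N t l)"
  have "(\<lambda>p. 2 * (1/2::real) ^ p) \<longlonglongrightarrow> 0" by real_asymp
  then have "\<forall>\<^sub>F p in sequentially. 2 * (1/2::real) ^ p < e"
    using \<open>0 < e\<close> by (rule order_tendstoD)
  then obtain p where p: "2 * (1/2::real) ^ p < e"
    by (auto simp: eventually_sequentially)
  obtain f where f: "bij_betw f {..<c} F"
    using ex_bij_betw_nat_finite[OF F(2)] by (auto simp: c_def atLeast0LessThan)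
  have "\<forall>j. \<exists>a. a \<in> cantor_A N S j"
    using cantor_A_nonempty[OF S] t by (auto simp: ex_in_conv)
  then obtain g where g: "\<And>j. g j \<in> cantor_A N S j" by metis
  define j where "j = (\<lambda>i. if i < c then l else p + i)"
  define b where "b = (\<lambda>i. if i < c then f i else g (p + i))"
  define I where "I = (\<lambda>i. {b i .. b i + 1 / real (cantor_M N (j i))})"
  have "G \<subseteq> (\<Union>i. I i)"
  proof
    fix y assume "y \<in> G"
    then obtain a where a: "a \<in> F" "y \<in> {a .. a + 1 / real (cantor_M N l)}" using G by blast
    then obtain i where "i < c" "a = f i" using f by (auto simp: bij_betw_def)
    then have "y \<in> I i" using a by (simp add: I_def b_def j_def)
    then show "y \<in> (\<Union>i. I i)" by blast
  qed
  moreover have "b i \<in> cantor_A N S (j i)" for i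
    using f F(1) g by (auto simp: b_def j_def bij_betw_def)
  then have "\<forall>i. I i \<in> cantor_B N S (j i)" by (auto simp: I_def cantor_B_def)
  ultimately have "cantor_sigma N t S G \<le> (\<Sum>i. ennreal (1 / real (cantor_T N t (j i))))"
    unfolding cantor_sigma_def by (intro Inf_lower) blast
  also have "\<dots> \<le> (\<Sum>i. ennreal (if i < c then w else 0) + ennreal ((1/2) ^ p * (1/2) ^ i))"
  proof (intro suminf_le allI)
    fix i
    show "ennreal (1 / real (cantor_T N t (j i)))
      \<le> ennreal (if i < c then w else 0) + ennreal ((1/2) ^ p * (1/2) ^ i)"
    proof (cases "i < c")
      case True
      then show ?thesis by (simp add: j_def w_def)
    next
      case False
      have "(2::real) ^ (p + i) \<le> real t ^ (p + i)"
        using t by (intro power_mono) auto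
      also have "\<dots> \<le> 2 ^ N * real t ^ (p + i)"
        using mult_right_mono[of 1 "2 ^ N" "real t ^ (p + i)"] by simp
      finally have "1 / (2 ^ N * real t ^ (p + i)) \<le> 1 / 2 ^ (p + i)"
        by (intro divide_left_mono) (use t in auto)
      then show ?thesis
        using False by (simp add: j_def cantor_T_def cantor_K_def power_add power_one_over
            ennreal_leI)
    qed
  qed auto
  also have "\<dots> = (\<Sum>i. ennreal (if i < c then w else 0)) + (\<Sum>i. ennreal ((1/2) ^ p * (1/2) ^ i))"
    by (intro suminf_add[symmetric]) auto
  also have "(\<Sum>i. ennreal (if i < c then w else 0)) = (\<Sum>i<c. ennreal (if i < c then w else 0))"
    by (intro suminf_finite) auto
  also have "\<dots> = ennreal (real c * w)"
    by (subst sum_ennreal) (auto simp: w_def)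
  also have "(\<Sum>i. ennreal ((1/2) ^ p * (1/2) ^ i)) = ennreal ((1/2) ^ p * 2)"
    by (rule suminf_ennreal_eq) (use sums_mult[OF geometric_sums[of "1/2::real"]] in auto)
  also have "ennreal (real c * w) + ennreal ((1/2) ^ p * 2) \<le> ennreal (real c * w) + ennreal e"
    using p by (intro add_left_mono ennreal_leI) simp
  finally show "cantor_sigma N t S G
      \<le> ennreal (real (card F) / real (cantor_T N t l)) + ennreal e"
    by (simp add: c_def w_def)
qed

lemma card_grid_le:
  fixes x y m :: real
  assumes "0 < m" and "x \<le> y" and "\<And>a. a \<in> F \<Longrightarrow> x \<le> a \<and> a \<le> y"
    and "\<And>a. a \<in> F \<Longrightarrow> \<exists>k :: int. a = of_int k / m"
  shows "finite F \<and> real (card F) \<le> m * (y - x) + 1"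
proof -
  let ?Z = "{\<lceil>m * x\<rceil> .. \<lfloor>m * y\<rfloor>}"
  have sub: "F \<subseteq> (\<lambda>k. of_int k / m) ` ?Z"
  proof
    fix a assume a: "a \<in> F"
    then obtain k :: int where k: "a = of_int k / m" using assms(4) by blast
    have "m * x \<le> of_int k" "of_int k \<le> m * y"
      using assms(3)[OF a] assms(1) by (simp_all add: k field_simps)
    then show "a \<in> (\<lambda>k. of_int k / m) ` ?Z"
      using k by (auto simp: ceiling_le_iff le_floor_iff)
  qed
  have "finite F" using finite_subset[OF sub] by simp
  moreover have "card F \<le> card ?Z"
    using card_mono[OF _ sub] card_image_le[of ?Z "\<lambda>k. of_int k / m"] by simp
  then have "real (card F) \<le> real (nat (\<lfloor>m * y\<rfloor> - \<lceil>m * x\<rceil> + 1))" by simp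
  moreover have "m * x \<le> m * y" using assms(1,2) by simp
  then have "real (nat (\<lfloor>m * y\<rfloor> - \<lceil>m * x\<rceil> + 1)) \<le> m * y - m * x + 1"
    by linarith
  ultimately show ?thesis by (simp add: algebra_simps)
qed

text \<open>
  A basic interval that meets \<open>[x, x + \<epsilon>]\<close> has its left endpoint in \<open>[x - 1 / M\<^sub>l, x + \<epsilon>]\<close>, an
  interval of \<open>M\<^sub>l \<epsilon> + 1\<close> meshes.
\<close>

lemma cantor_sigma_interval_le:
  assumes S: "cantor_choice N t S" and N: "0 < N" and t: "2 \<le> t" and e: "0 \<le> \<epsilon>"
  shows "cantor_sigma N t S ({x .. x + \<epsilon>} \<inter> cantor_E N S)
    \<le> ennreal ((real (cantor_M N l) * \<epsilon> + 2) / real (cantor_T N t l))"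
proof -
  let ?m = "real (cantor_M N l)"
  define F where "F = {a \<in> cantor_A N S l. x - 1 / ?m \<le> a \<and> a \<le> x + \<epsilon>}"
  have m: "0 < ?m" using cantor_M_pos[OF N] by simp
  have F: "finite F \<and> real (card F) \<le> ?m * ((x + \<epsilon>) - (x - 1 / ?m)) + 1"
  proof (rule card_grid_le[OF m])
    show "x - 1 / ?m \<le> x + \<epsilon>" using e m by (smt (verit) divide_pos_pos)
    fix a assume a: "a \<in> F"
    then show "x - 1 / ?m \<le> a \<and> a \<le> x + \<epsilon>" by (simp add: F_def)
    show "\<exists>k :: int. a = of_int k / ?m"
      using a cantor_A_in_grid[OF S N] by (metis (no_types, lifting) F_def mem_Collect_eq of_int_of_nat_eq)
  qed
  have "{x .. x + \<epsilon>} \<inter> cantor_E N S \<subseteq> (\<Union>a\<in>F. {a .. a + 1 / ?m})"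
    using cantor_E_subset_level[OF S N, of l] by (fastforce simp: F_def cantor_B_def)
  then have "cantor_sigma N t S ({x .. x + \<epsilon>} \<inter> cantor_E N S)
      \<le> ennreal (real (card F) / real (cantor_T N t l))"
    using F by (intro cantor_sigma_le_finite_cover[OF S t]) (auto simp: F_def)
  also have "?m * ((x + \<epsilon>) - (x - 1 / ?m)) + 1 = ?m * \<epsilon> + 2"
    using m by (simp add: algebra_simps)
  then have "ennreal (real (card F) / real (cantor_T N t l))
      \<le> ennreal ((?m * \<epsilon> + 2) / real (cantor_T N t l))"
    using F by (intro ennreal_leI divide_right_mono) auto
  finally show ?thesis .
qed

section \<open>Choosing the level\<close>

text \<open>
  The two largeness hypotheses belong to different scales: \<open>large0\<close> pays for the additive error
  \<open>2 / K\<close> when \<open>\<epsilon> \<ge> 1 / K\<close>, and \<open>large1\<close> for the loss within one step of ratio \<open>N\<close> between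
  consecutive meshes when \<open>\<epsilon> < 1 / K\<close>.
\<close>

lemma exists_level_bound:
  fixes N t :: nat and \<alpha> C1 \<epsilon> :: real
  assumes \<alpha>: "0 < \<alpha>" "\<alpha> < 1" and C1: "1 < C1" and N: "2 \<le> N"
    and t: "real t = real N powr \<alpha>" and \<epsilon>: "0 < \<epsilon>" "\<epsilon> \<le> 1"
    and large0: "2 \<le> (C1 - 1) * (2 ^ N) powr (1 - \<alpha>)"
    and large1: "3 * real N powr (1 - \<alpha>) \<le> (2 ^ N) powr (1 - \<alpha>)"
  shows "\<exists>l. (real (cantor_M N l) * \<epsilon> + 2) / real (cantor_T N t l) \<le> C1 * \<epsilon> powr \<alpha>"
proof -
  define K :: real where "K = 2 ^ N"
  have K: "0 < K" "1 \<le> K" by (simp_all add: K_def)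
  have M: "real (cantor_M N l) = K * real N ^ l" for l
    by (simp add: cantor_M_def cantor_K_def K_def)
  have T: "real (cantor_T N t l) = K * real t ^ l" for l
    by (simp add: cantor_T_def cantor_K_def K_def)
  have "\<exists>l. 1 \<le> K * real N ^ l * \<epsilon>"
  proof -
    have "1 < real N" using N by simp
    then obtain l where "1 / (K * \<epsilon>) < real N ^ l" using real_arch_pow by blast
    then have "1 \<le> K * real N ^ l * \<epsilon>" using K \<epsilon> by (simp add: field_simps)
    then show ?thesis by blast
  qed
  then obtain l where l: "1 \<le> K * real N ^ l * \<epsilon>"
    and least: "\<And>i. i < l \<Longrightarrow> K * real N ^ i * \<epsilon> < 1"
    using exists_least_iff[of "\<lambda>l. 1 \<le> K * real N ^ l * \<epsilon>"] by (auto simp: not_le)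
  have "(K * real N ^ l * \<epsilon> + 2) / (K * real t ^ l) \<le> C1 * \<epsilon> powr \<alpha>"
  proof (cases l)
    case 0
    have "1 = 1 powr \<alpha>" by simp
    also have "\<dots> \<le> (K * \<epsilon>) powr \<alpha>" using l \<alpha> 0 by (intro powr_mono2) auto
    also have "\<dots> = K powr \<alpha> * \<epsilon> powr \<alpha>" using K \<epsilon> by (simp add: powr_mult)
    finally have K\<epsilon>: "1 \<le> K powr \<alpha> * \<epsilon> powr \<alpha>" .
    have "2 \<le> (C1 - 1) * K powr (1 - \<alpha>)" using large0 by (simp add: K_def)
    also have "\<dots> \<le> (C1 - 1) * K powr (1 - \<alpha>) * (K powr \<alpha> * \<epsilon> powr \<alpha>)"
      using mult_left_mono[OF K\<epsilon>, of "(C1 - 1) * K powr (1 - \<alpha>)"] C1 by simp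
    also have "\<dots> = (C1 - 1) * (K powr (1 - \<alpha>) * K powr \<alpha>) * \<epsilon> powr \<alpha>"
      by simp
    also have "K powr (1 - \<alpha>) * K powr \<alpha> = K" using K by (simp flip: powr_add)
    finally have 2: "2 / K \<le> (C1 - 1) * \<epsilon> powr \<alpha>"
      using K by (simp add: field_simps)
    have "\<epsilon> = \<epsilon> powr 1" using \<epsilon> by simp
    also have "\<dots> \<le> \<epsilon> powr \<alpha>" using \<epsilon> \<alpha> by (intro powr_mono') auto
    finally have "\<epsilon> + 2 / K \<le> C1 * \<epsilon> powr \<alpha>" using 2 by (simp add: algebra_simps)
    moreover have "(K * \<epsilon> + 2) / K = \<epsilon> + 2 / K" using K by (simp add: field_simps)
    ultimately show ?thesis by (simp add: 0)
  next
    case (Suc i)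
    define u where "u = K * real N ^ l * \<epsilon>"
    have u1: "1 \<le> u" using l by (simp add: u_def)
    have "u = real N * (K * real N ^ i * \<epsilon>)" by (simp add: u_def Suc)
    also have "\<dots> \<le> real N * 1" using least[of i] Suc by (intro mult_left_mono) auto
    finally have uN: "u \<le> real N" by simp
    have "(real N ^ l) powr \<alpha> = real t ^ l"
      using N by (simp add: t powr_powr powr_realpow[symmetric] mult.commute flip: powr_realpow)
    then have u\<alpha>: "u powr \<alpha> = K powr \<alpha> * real t ^ l * \<epsilon> powr \<alpha>"
      using K \<epsilon> by (simp add: u_def powr_mult)
    have "u + 2 \<le> 3 * u" using u1 by simp
    also have "\<dots> = 3 * u powr (1 - \<alpha>) * u powr \<alpha>" using u1 by (simp add: mult.assoc flip: powr_add)
    also have "\<dots> \<le> 3 * real N powr (1 - \<alpha>) * u powr \<alpha>"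
      using u1 uN \<alpha> by (intro mult_right_mono mult_left_mono powr_mono2) auto
    also have "\<dots> \<le> K powr (1 - \<alpha>) * u powr \<alpha>"
      using large1 by (intro mult_right_mono) (auto simp: K_def)
    also have "\<dots> = (K powr (1 - \<alpha>) * K powr \<alpha>) * real t ^ l * \<epsilon> powr \<alpha>"
      by (simp add: u\<alpha>)
    also have "K powr (1 - \<alpha>) * K powr \<alpha> = K" using K by (simp flip: powr_add)
    finally have "u + 2 \<le> K * real t ^ l * \<epsilon> powr \<alpha>" .
    moreover have "0 < real t" using t N by simp
    ultimately have "(u + 2) / (K * real t ^ l) \<le> \<epsilon> powr \<alpha>"
      using K by (simp add: field_simps)
    also have "\<dots> \<le> C1 * \<epsilon> powr \<alpha>" using C1 by (simp add: mult_le_cancel_right1)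
    finally show ?thesis by (simp add: u_def)
  qed
  then show ?thesis by (auto simp: M T)
qed

theorem lemma6p1:
  fixes \<alpha> C1 :: real
  assumes "0 < \<alpha>" and "\<alpha> < 1" and "1 < C1"
  shows "\<exists>Nstar :: nat. \<forall>(N0 :: nat) (t0 :: nat) (n :: nat) (S :: nat \<Rightarrow> real \<Rightarrow> real set).
    1 \<le> t0 \<and> t0 \<le> N0 \<and> \<alpha> = ln (real t0) / ln (real N0) \<and>
    1 \<le> n \<and> Nstar \<le> N0 ^ n \<and> cantor_choice (N0 ^ n) (t0 ^ n) S \<longrightarrow>
    (\<forall>(x :: real) (\<epsilon> :: real). 0 < \<epsilon> \<and> \<epsilon> \<le> 1 \<longrightarrow>
       cantor_sigma (N0 ^ n) (t0 ^ n) S ({x .. x + \<epsilon>} \<inter> cantor_E (N0 ^ n) S)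
         \<le> ennreal (C1 * \<epsilon> powr \<alpha>))"
proof -
  define \<beta> where "\<beta> = 1 - \<alpha>"
  have \<beta>: "0 < \<beta>" using assms by (simp add: \<beta>_def)
  have "filterlim (\<lambda>N::nat. (2 ^ N :: real) powr \<beta>) at_top at_top" using \<beta> by real_asymp
  then have "\<forall>\<^sub>F N::nat in at_top. 2 / (C1 - 1) \<le> (2 ^ N) powr \<beta>"
    by (auto simp: filterlim_at_top)
  moreover have "\<forall>\<^sub>F N::nat in at_top. 3 * real N powr \<beta> \<le> (2 ^ N) powr \<beta>"
    using \<beta> by real_asymp
  ultimately have "\<forall>\<^sub>F N::nat in at_top.
      2 / (C1 - 1) \<le> (2 ^ N) powr \<beta> \<and> 3 * real N powr \<beta> \<le> (2 ^ N) powr \<beta>"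
    by (rule eventually_conj)
  then obtain Nstar :: nat where Nstar: "\<And>N. Nstar \<le> N \<Longrightarrow>
      2 / (C1 - 1) \<le> (2 ^ N) powr \<beta> \<and> 3 * real N powr \<beta> \<le> (2 ^ N) powr \<beta>"
    by (auto simp: eventually_at_top_linorder)
  show ?thesis
  proof (intro exI[of _ Nstar] allI impI, elim conjE)
    fix N0 t0 n :: nat and S and x \<epsilon> :: real
    assume t0: "1 \<le> t0" "t0 \<le> N0" and \<alpha>: "\<alpha> = ln (real t0) / ln (real N0)"
      and n: "1 \<le> n" and large: "Nstar \<le> N0 ^ n"
      and S: "cantor_choice (N0 ^ n) (t0 ^ n) S" and \<epsilon>: "0 < \<epsilon>" "\<epsilon> \<le> 1"
    \<comment> \<open>The value \<open>\<alpha> = 0\<close> that \<open>t0 = 1\<close> would give is excluded.\<close>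
    have "t0 \<noteq> 1" using \<alpha> assms(1) by auto
    then have t0_2: "2 \<le> t0" and N0_2: "2 \<le> N0" using t0 by auto
    have "t0 ^ 1 \<le> t0 ^ n" "N0 ^ 1 \<le> N0 ^ n"
      using t0_2 N0_2 n by (intro power_increasing; simp)+
    then have t2: "2 \<le> t0 ^ n" and N2: "2 \<le> N0 ^ n" using t0_2 N0_2 by auto
    have "real t0 = real N0 powr \<alpha>"
      using t0_2 N0_2 by (simp add: \<alpha> powr_def)
    then have t: "real (t0 ^ n) = real (N0 ^ n) powr \<alpha>"
      using N0_2 by (simp add: powr_powr mult.commute flip: powr_realpow)
    have "2 \<le> (C1 - 1) * (2 ^ (N0 ^ n)) powr (1 - \<alpha>)"
      using Nstar[OF large] assms(3) by (simp add: \<beta>_def field_simps)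
    then obtain l where "(real (cantor_M (N0 ^ n) l) * \<epsilon> + 2) / real (cantor_T (N0 ^ n) (t0 ^ n) l)
        \<le> C1 * \<epsilon> powr \<alpha>"
      using exists_level_bound[OF assms N2 t \<epsilon>] Nstar[OF large] by (auto simp: \<beta>_def)
    then have "ennreal ((real (cantor_M (N0 ^ n) l) * \<epsilon> + 2) / real (cantor_T (N0 ^ n) (t0 ^ n) l))
        \<le> ennreal (C1 * \<epsilon> powr \<alpha>)"
      by (rule ennreal_leI)
    moreover have "cantor_sigma (N0 ^ n) (t0 ^ n) S ({x .. x + \<epsilon>} \<inter> cantor_E (N0 ^ n) S)
        \<le> ennreal ((real (cantor_M (N0 ^ n) l) * \<epsilon> + 2) / real (cantor_T (N0 ^ n) (t0 ^ n) l))"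
      using N0_2 \<epsilon> by (intro cantor_sigma_interval_le[OF S _ t2]) auto
    ultimately show "cantor_sigma (N0 ^ n) (t0 ^ n) S ({x .. x + \<epsilon>} \<inter> cantor_E (N0 ^ n) S)
        \<le> ennreal (C1 * \<epsilon> powr \<alpha>)"
      by (rule order_trans[rotated])
  qed
qed

end
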